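(* Let $k\ge 2$ be an integer. For a nonnegative integer $n$ let $s_k(n)$ denote the number of occurrences of the pattern $11\ldots1$ (consisting of $k$ ones) in the binary representation of $n$ (occurrences may overlap), and let $\mathcal{P}_k=(p_n)_{n=0}^\infty$ be the sequence over $\mathbb{F}_2$ given by $p_n\equiv s_k(n)\bmod 2$. Let $\mathcal{P}_k'=(p_{i^2})_{i=0}^\infty$ be its subsequence along the squares. Then for every integer $N\ge 2^{2k+2}$, the $N$th maximum order complexity of $\mathcal{P}_k'$ satisfies $$M(\mathcal{P}_k',N)\ge \left(\frac{N}{8}\right)^{1/2}.$$
   Context: For a positive integer $N$ and a sequence $\mathcal{S}=(s_i)_{i=0}^\infty$ over $\mathbb{F}_2$ with $(s_0,\ldots,s_{N-2})$ not constant, the $N$th maximum order complexity $M(\mathcal{S},N)$ is the smallest positive integer $M$ such that there is a polynomial $f\in\mathbb{F}_2[x_1,\ldots,x_M]$ with $s_{i+M}=f(s_i,s_{i+1},\ldots,s_{i+M-1})$ for all $0\le i\le N-M-1$. If $s_i=a$ for all $i=0,\ldots,N-2$, then $M(\mathcal{S},N)=0$ if $s_{N-1}=a$ and $M(\mathcal{S},N)=N-1$ if $s_{N-1}\ne a$. For $k=2$, $\mathcal{P}_2$ is the Rudin-Shapiro sequence. *)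

theory Defs
  imports Complex_Main "HOL-Library.Z2" "HOL-Library.Poly_Mapping"
begin

(* The field with two elements is the library type bit; the operator bit n j tests digit j of n.
   A multivariate polynomial is a finitely supported map from monomials to coefficients,
   a monomial being a finitely supported map from variable indices to exponents. *)

type_synonym 'a mpoly_nat = "(nat \<Rightarrow>\<^sub>0 nat) \<Rightarrow>\<^sub>0 'a"

definition polys_in_vars :: "nat \<Rightarrow> 'a::comm_semiring_1 mpoly_nat set" where
  "polys_in_vars M = {f. \<forall>m\<in>Poly_Mapping.keys f. Poly_Mapping.keys m \<subseteq> {1..M}}"

definition eval_mpoly :: "'a::comm_semiring_1 mpoly_nat \<Rightarrow> (nat \<Rightarrow> 'a) \<Rightarrow> 'a" where
  "eval_mpoly f x =
     (\<Sum>m\<in>Poly_Mapping.keys f. Poly_Mapping.lookup f m *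
        (\<Prod>j\<in>Poly_Mapping.keys m. x j ^ Poly_Mapping.lookup m j))"

(* Variable x_j receives s_(i+j-1), for j = 1..M; the index range i <= N - M - 1 of integers
   is written i + M < N, so it is empty when M >= N. *)
definition has_recurrence :: "(nat \<Rightarrow> bit) \<Rightarrow> nat \<Rightarrow> nat \<Rightarrow> bool" where
  "has_recurrence s N M \<longleftrightarrow>
     (\<exists>f\<in>polys_in_vars M. \<forall>i. i + M < N \<longrightarrow> s (i + M) = eval_mpoly f (\<lambda>j. s (i + j - 1)))"

(* Meant for N >= 1; for N = 1 both exceptional values are 0. *)
definition max_order_complexity :: "(nat \<Rightarrow> bit) \<Rightarrow> nat \<Rightarrow> nat" where
  "max_order_complexity s N =
     (if \<forall>i<N - 1. s i = s 0
      then (if s (N - 1) = s 0 then 0 else N - 1)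
      else (LEAST M. M > 0 \<and> has_recurrence s N M))"

(* Occurrences are indexed by the position of their least significant digit. The digits of n
   above its leading one are 0, so none of them takes part in an occurrence. *)
definition ones_pattern_count :: "nat \<Rightarrow> nat \<Rightarrow> nat" where
  "ones_pattern_count k n = card {j. \<forall>i<k. bit n (j + i)}"

definition pattern_seq :: "nat \<Rightarrow> nat \<Rightarrow> bit" where
  "pattern_seq k n = of_nat (ones_pattern_count k n)"

definition pattern_seq_squares :: "nat \<Rightarrow> nat \<Rightarrow> bit" where
  "pattern_seq_squares k i = pattern_seq k (i ^ 2)"

end

theory Submission
  imports Defs
begin

text \<open>If two windows of length \<open>L\<close> of a sequence agree but are followed by different terms, then no
  recurrence of order at most \<open>L\<close> exists. Choose \<open>a\<close> with \<open>2\<^sup>a\<^sup>+\<^sup>2 \<le> N < 2\<^sup>a\<^sup>+\<^sup>3\<close> and compare the windows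
  of the subsequence along squares that start at \<open>2\<^sup>a\<close> and \<open>2\<^sup>a\<^sup>+\<^sup>1\<close>. As long as
  \<open>t\<^sup>2 < 2\<^sup>a\<close>, both \<open>(2\<^sup>a + t)\<^sup>2\<close> and \<open>(2\<^sup>a\<^sup>+\<^sup>1 + t)\<^sup>2\<close> consist of the digit blocks of \<open>t\<^sup>2\<close>, \<open>t\<close>
  and \<open>1\<close> separated by zeros, so the pattern counts agree. The first disagreement \<open>L\<close>
  therefore satisfies \<open>L\<^sup>2 \<ge> 2\<^sup>a > N / 8\<close>. Some disagreement with \<open>t < 2\<^sup>a\<^sup>+\<^sup>1\<close> exists: since multiplication
  by powers of two does not change the count, a single small example for each \<open>k\<close> suffices.\<close>

section \<open>Recurrences and repeated windows\<close>

lemma eval_mpoly_cong: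
  assumes "f \<in> polys_in_vars M" and "\<And>j. j \<in> {1..M} \<Longrightarrow> x j = y j"
  shows "eval_mpoly f x = eval_mpoly f y"
proof -
  have "x j = y j" if "m \<in> Poly_Mapping.keys f" "j \<in> Poly_Mapping.keys m" for m j
    using that assms unfolding polys_in_vars_def by blast
  then show ?thesis
    unfolding eval_mpoly_def by (intro sum.cong arg_cong2[where f="(*)"] prod.cong) auto
qed

lemma has_recurrence_unique_continuation:
  assumes "has_recurrence s N M" and "i + M < N" and "j + M < N"
    and "\<And>t. t < M \<Longrightarrow> s (i + t) = s (j + t)"
  shows "s (i + M) = s (j + M)"
proof -
  obtain f where f: "f \<in> polys_in_vars M"
    and rec: "\<And>i. i + M < N \<Longrightarrow> s (i + M) = eval_mpoly f (\<lambda>j. s (i + j - 1))"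
    using assms(1) unfolding has_recurrence_def by blast
  have "s (i + l - 1) = s (j + l - 1)" if "l \<in> {1..M}" for l
    using assms(4)[of "l - 1"] that by (cases l) auto
  then have "eval_mpoly f (\<lambda>l. s (i + l - 1)) = eval_mpoly f (\<lambda>l. s (j + l - 1))"
    by (intro eval_mpoly_cong[OF f]) simp
  then show ?thesis
    using rec assms(2,3) by simp
qed

text \<open>For \<open>M = N\<close> the index range is empty, so the zero polynomial works; hence
  the \<open>LEAST\<close> is attained.\<close>

lemma has_recurrence_refl: "has_recurrence s N N"
  unfolding has_recurrence_def polys_in_vars_def by (auto intro!: exI[of _ 0])

lemma max_order_complexity_gt:
  assumes "i + L < N" and "j + L < N"
    and eq: "\<And>t. t < L \<Longrightarrow> s (i + t) = s (j + t)"
    and neq: "s (i + L) \<noteq> s (j + L)"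
  shows "L < max_order_complexity s N"
proof (cases "\<forall>i<N - 1. s i = s 0")
  \<comment> \<open>With \<open>s (N - 1) = s 0\<close> the first \<open>N\<close> terms would be
    constant, against \<open>neq\<close>; so the value is \<open>N - 1\<close>.\<close>
  case True
  have "s n = s 0" if "n < N" "s (N - 1) = s 0" for n
  proof (cases "n = N - 1")
    case False
    then have "n < N - 1"
      using that by simp
    then show ?thesis
      using True by blast
  qed (use that in simp)
  from this[of "i + L"] this[of "j + L"] have "s (N - 1) \<noteq> s 0"
    using neq assms(1,2) by auto
  moreover have "i \<noteq> j"
    using neq by blast
  then have "L < N - 1"
    using assms(1,2) by linarith
  ultimately show ?thesis
    unfolding max_order_complexity_def if_P[OF True] by simp
next
  case False
  define M where "M = (LEAST M. M > 0 \<and> has_recurrence s N M)"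
  have "N > 0 \<and> has_recurrence s N N"
    using assms(1) has_recurrence_refl by simp
  then have M: "M > 0 \<and> has_recurrence s N M"
    unfolding M_def by (rule LeastI)
  have "L < M"
  proof (rule ccontr)
    assume "\<not> L < M"
    \<comment> \<open>A recurrence of order \<open>M\<close> sees only the last \<open>M\<close>
      terms of the two windows, so both starting points move by \<open>d\<close>.\<close>
    define d where "d = L - M"
    have L: "L = d + M"
      using \<open>\<not> L < M\<close> by (simp add: d_def)
    have "s (i + d + M) = s (j + d + M)"
    proof (rule has_recurrence_unique_continuation)
      show "s (i + d + t) = s (j + d + t)" if "t < M" for t
        using eq[of "d + t"] that L by (simp add: add.assoc)
    qed (use M assms(1,2) L in auto)
    then show False
      using neq L by (simp add: add.assoc)
  qed
  then show ?thesis
    unfolding max_order_complexity_def if_not_P[OF False] M_def .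
qed

section \<open>Counting runs of ones\<close>

lemma not_bit_nat_of_less:
  fixes n :: nat
  assumes "n < 2 ^ m" and "m \<le> j"
  shows "\<not> bit n j"
proof -
  have "n < 2 ^ j"
    using assms by (meson less_le_trans one_le_numeral power_increasing)
  then show ?thesis
    by (simp add: bit_iff_odd)
qed

lemma finite_ones_pattern:
  assumes "k > 0"
  shows "finite {j. \<forall>i<k. bit (n::nat) (j + i)}"
proof (rule finite_subset)
  show "{j. \<forall>i<k. bit n (j + i)} \<subseteq> {..<n}"
  proof safe
    fix j assume "\<forall>i<k. bit n (j + i)"
    then have "bit n j"
      using assms by (metis add.right_neutral)
    then show "j < n"
      using not_bit_nat_of_less[of n n j] less_exp[of n] by (meson not_le)
  qed
qed simp

text \<open>Digit \<open>m\<close> of the sum is a zero separating \<open>x\<close> from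
  \<open>y\<close>, so no occurrence straddles the two blocks.\<close>

lemma ones_pattern_count_append:
  assumes k: "k > 0" and x: "x < 2 ^ m"
  shows "ones_pattern_count k (x + 2 ^ Suc m * y) = ones_pattern_count k x + ones_pattern_count k y"
proof -
  let ?n = "x + 2 ^ Suc m * y"
  let ?P = "\<lambda>n. {j. \<forall>i<k. bit (n::nat) (j + i)}"
  have xm: "x < 2 ^ Suc m"
    using x by simp
  have low: "bit ?n j \<longleftrightarrow> bit x j" if "j \<le> m" for j
  proof -
    have "take_bit (Suc m) ?n = take_bit (Suc m) x"
      by (simp add: take_bit_eq_mod del: power_Suc)
    then have "bit (take_bit (Suc m) ?n) j = bit (take_bit (Suc m) x) j"
      by (rule arg_cong)
    then show ?thesis
      using that by (simp add: bit_take_bit_iff del: power_Suc)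
  qed
  have high: "bit ?n (Suc m + j) \<longleftrightarrow> bit y j" for j
  proof -
    have "?n div 2 ^ Suc m = y"
      using xm by (simp del: power_Suc)
    then have "drop_bit (Suc m) ?n = y"
      by (simp add: drop_bit_eq_div del: power_Suc)
    then show ?thesis
      by (metis bit_drop_bit_eq comp_apply add.commute)
  qed
  have gap: "\<not> bit ?n m"
    using low[of m] not_bit_nat_of_less[OF x order_refl] by simp
  have bitx: "j < m" if "bit x j" for j
    using not_bit_nat_of_less[OF x] that by (meson not_le)
  have "?P ?n = ?P x \<union> (\<lambda>j. Suc m + j) ` ?P y"
  proof (intro set_eqI iffI)
    fix j assume j: "j \<in> ?P ?n"
    show "j \<in> ?P x \<union> (\<lambda>j. Suc m + j) ` ?P y"
    proof (cases "j \<le> m")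
      case True
      have "j + i \<le> m" if "i < k" for i
      proof (rule ccontr)
        assume "\<not> j + i \<le> m"
        then have "m - j < k" "j + (m - j) = m"
          using that True by auto
        then show False
          using j gap by (metis mem_Collect_eq)
      qed
      then have "j \<in> ?P x"
        using j low by auto
      then show ?thesis ..
    next
      case False
      then obtain d where d: "j = Suc m + d"
        by (metis not_less_eq_eq le_Suc_ex)
      then have "d \<in> ?P y"
        using j high by (auto simp: add.assoc simp del: power_Suc add_Suc)
      then show ?thesis
        using d by blast
    qed
  next
    fix j assume "j \<in> ?P x \<union> (\<lambda>j. Suc m + j) ` ?P y"
    then show "j \<in> ?P ?n"
    proof
      assume "j \<in> ?P x"
      then show ?thesis
        using low bitx by (auto simp: less_imp_le simp del: power_Suc)
    next
      assume "j \<in> (\<lambda>j. Suc m + j) ` ?P y"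
      then show ?thesis
        using high by (auto simp: add.assoc simp del: power_Suc add_Suc)
    qed
  qed
  moreover have "?P x \<inter> (\<lambda>j. Suc m + j) ` ?P y = {}"
  proof -
    have "j < m" if "j \<in> ?P x" for j
      using that bitx[of j] k by (auto dest: spec[of _ 0])
    then have "?P x \<subseteq> {..<m}"
      by blast
    moreover have "(\<lambda>j. Suc m + j) ` ?P y \<subseteq> {m<..}"
      by auto
    ultimately show ?thesis
      by (blast dest: less_asym)
  qed
  ultimately show ?thesis
    unfolding ones_pattern_count_def
    using finite_ones_pattern[OF k] by (simp only: card_Un_disjoint finite_imageI card_image inj_on_add)
qed

lemma ones_pattern_count_eq_0:
  assumes "n < 2 ^ (k - 1)" and "k > 0"
  shows "ones_pattern_count k n = 0"
proof -
  have "\<not> bit n (j + (k - 1))" for j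
    using not_bit_nat_of_less[OF assms(1)] by simp
  then have "{j. \<forall>i<k. bit n (j + i)} = {}"
    using assms(2) by (auto intro!: exI[of _ "k - 1"])
  then show ?thesis
    unfolding ones_pattern_count_def by (metis card.empty)
qed

lemma ones_pattern_count_Suc_0:
  assumes "k \<ge> 2"
  shows "ones_pattern_count k (Suc 0) = 0"
proof -
  have "Suc 0 < 2 ^ (k - 1)"
    using assms one_less_power[of "2::nat" "k - 1"] by simp
  then show ?thesis
    using assms by (intro ones_pattern_count_eq_0) auto
qed

lemma ones_pattern_count_mask:
  assumes "k > 0"
  shows "ones_pattern_count k (2 ^ k - 1) = 1"
proof -
  have "bit (2 ^ k - 1 :: nat) j \<longleftrightarrow> j < k" for j
    using bit_mask_iff[of k j, where ?'a=nat] by (simp add: mask_eq_exp_minus_1)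
  moreover have "(\<forall>i<k. j + i < k) \<longleftrightarrow> j = 0" for j
    using assms by (auto dest: spec[of _ "k - 1"])
  ultimately show ?thesis
    by (simp add: ones_pattern_count_def)
qed

lemma ones_pattern_count_shift:
  assumes "k > 0"
  shows "ones_pattern_count k (2 ^ m * n) = ones_pattern_count k n"
proof (cases m)
  case (Suc l)
  then show ?thesis
    using ones_pattern_count_append[OF assms, of 0 l n] ones_pattern_count_eq_0[OF _ assms, of 0]
    by simp
qed simp

section \<open>The sequence along squares\<close>

lemma pattern_seq_squares_shift:
  assumes "k > 0"
  shows "pattern_seq_squares k (2 ^ m * n) = pattern_seq_squares k n"
  using ones_pattern_count_shift[OF assms, of "m * 2" "n ^ 2"]
  by (simp add: pattern_seq_squares_def pattern_seq_def power_mult_distrib power_mult)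

text \<open>The square is \<open>t ^ 2 + 2 ^ Suc a * t + 2 ^ (2 * a)\<close>, with zeros at digits
  \<open>a\<close> and \<open>2 * a - 1\<close>. The right-hand side does not depend on
  \<open>a\<close>, so \<open>a\<close> and \<open>Suc a\<close> give equal counts.\<close>

lemma ones_pattern_count_square_add_power:
  assumes k: "k \<ge> 2" and a: "a \<ge> 4" and t: "t ^ 2 < 2 ^ a"
  shows "ones_pattern_count k ((2 ^ a + t) ^ 2) = ones_pattern_count k (t ^ 2) + ones_pattern_count k t"
proof -
  have t': "t < 2 ^ (a - 2)"
  proof (rule ccontr)
    assume "\<not> ?thesis"
    then have "(2 ^ (a - 2)) ^ 2 \<le> t ^ 2"
      by (intro power_mono) auto
    also have "\<dots> < 2 ^ a"
      by (rule t)
    finally have "(2::nat) ^ ((a - 2) * 2) < 2 ^ a"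
      by (simp add: power_mult)
    then have "(a - 2) * 2 < a"
      by (rule power_less_imp_less_exp[rotated]) simp
    then show False
      using a by simp
  qed
  have a2: "(2::nat) ^ Suc a * 2 ^ Suc (a - 2) = (2 ^ a) ^ 2"
    using a by (simp flip: power_add power_mult power_Suc add: mult_2_right)
  have "(2 ^ a + t) ^ 2 = t ^ 2 + 2 ^ Suc a * (t + 2 ^ Suc (a - 2) * 1)"
    unfolding distrib_left mult.assoc[symmetric] a2 by (simp add: power2_sum)
  also have "ones_pattern_count k \<dots> =
      ones_pattern_count k (t ^ 2) + ones_pattern_count k (t + 2 ^ Suc (a - 2) * 1)"
    using k t by (intro ones_pattern_count_append) auto
  also have "ones_pattern_count k (t + 2 ^ Suc (a - 2) * 1) =
      ones_pattern_count k t + ones_pattern_count k 1"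
    using k t' by (intro ones_pattern_count_append) auto
  also have "ones_pattern_count k 1 = 0"
    using ones_pattern_count_Suc_0[OF k] by simp
  finally show ?thesis
    by simp
qed

text \<open>In both cases exactly one of the two squares contains the pattern an odd number of times:
  \<open>3\<^sup>2 = 1001\<close> and \<open>5\<^sup>2 = 11001\<close> in binary for \<open>k = 2\<close>, and \<open>(2\<^sup>k\<^sup>+\<^sup>1 - 1)\<^sup>2\<close> and
  \<open>(3 * 2\<^sup>k - 1)\<^sup>2\<close> for \<open>k > 2\<close>.\<close>

lemma pattern_seq_squares_differ_base:
  assumes "k \<ge> 2"
  obtains c u where "c \<le> k" "u < 2 ^ Suc c"
    "pattern_seq_squares k (2 ^ c + u) \<noteq> pattern_seq_squares k (2 ^ Suc c + u)"
proof (cases "k = 2")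
  case True
  have "ones_pattern_count 2 (1 + 2 ^ Suc 2 * 1) = 0"
    by (subst ones_pattern_count_append) (auto simp: ones_pattern_count_eq_0)
  moreover have "ones_pattern_count 2 (1 + 2 ^ Suc 2 * 3) = 1"
    using ones_pattern_count_mask[of 2]
    by (subst ones_pattern_count_append) (auto simp: ones_pattern_count_eq_0)
  ultimately have "pattern_seq_squares k (2 ^ 1 + 1) \<noteq> pattern_seq_squares k (2 ^ Suc 1 + 1)"
    using True by (simp add: pattern_seq_squares_def pattern_seq_def)
  then show ?thesis
    using True by (intro that[of 1 1]) auto
next
  case False
  then obtain l where l: "k = l + 3"
    using assms by (metis add.commute le_Suc_ex le_neq_implies_less Suc_leI numeral_3_eq_3 numeral_2_eq_2)
  \<comment> \<open>The squares become polynomials in \<open>x\<close>; writing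
    \<open>x = Suc y\<close> removes truncated subtraction.\<close>
  define x :: nat where "x = 2 ^ l"
  have x: "x \<ge> 1"
    by (simp add: x_def)
  then obtain y where y: "x = Suc y"
    by (cases x) auto
  have k8: "2 ^ k = 8 * x"
    by (simp add: l x_def power_add)
  have "ones_pattern_count k (1 + 2 ^ Suc (k + 1) * (2 ^ k - 1)) = 1"
    using assms ones_pattern_count_mask[of k]
    by (subst ones_pattern_count_append)
      (auto simp: ones_pattern_count_Suc_0 intro: less_le_trans[of _ 2])
  moreover have "1 + 2 ^ Suc (k + 1) * (2 ^ k - 1) = (2 ^ k + (2 ^ k - 1) :: nat) ^ 2"
    by (simp add: k8 y power2_eq_square algebra_simps)
  ultimately have 1: "ones_pattern_count k ((2 ^ k + (2 ^ k - 1)) ^ 2) = 1"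
    by simp
  \<comment> \<open>The middle block of \<open>(3 * 2 ^ k - 1) ^ 2\<close> is
    \<open>2 ^ (k - 1) - 3\<close>, which is nonnegative only for \<open>k > 2\<close> and has fewer
    than \<open>k\<close> digits.\<close>
  have less: "4 * x - 3 < 2 ^ (k - 1)"
    using x by (simp add: l x_def power_add)
  have less': "4 * x - 3 < 2 ^ (k + 1)"
    using k8 x by simp
  have "ones_pattern_count k (1 + 2 ^ Suc k * (4 * x - 3 + 2 ^ Suc (k + 1) * 1)) = 0"
    using ones_pattern_count_append[of k 1 k "4 * x - 3 + 2 ^ Suc (k + 1) * 1"]
      ones_pattern_count_append[OF _ less', of k 1] ones_pattern_count_eq_0[OF less]
      ones_pattern_count_Suc_0[OF assms] one_less_power[of "2::nat" k] assms
    by (simp del: power_Suc)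
  moreover have "1 + 2 ^ Suc k * (4 * x - 3 + 2 ^ Suc (k + 1) * 1) = (2 ^ Suc k + (2 ^ k - 1) :: nat) ^ 2"
    by (simp add: k8 y power2_eq_square algebra_simps)
  ultimately have 2: "ones_pattern_count k ((2 ^ Suc k + (2 ^ k - 1)) ^ 2) = 0"
    by simp
  have "pattern_seq_squares k (2 ^ k + (2 ^ k - 1)) \<noteq> pattern_seq_squares k (2 ^ Suc k + (2 ^ k - 1))"
    unfolding pattern_seq_squares_def pattern_seq_def 1 2 by simp
  then show ?thesis
    by (intro that[of k "2 ^ k - 1"]) (auto simp: less_imp_diff_less)
qed

lemma pattern_seq_squares_differ:
  assumes "k \<ge> 2" and "k \<le> a"
  obtains t where "t < 2 ^ Suc a"
    "pattern_seq_squares k (2 ^ a + t) \<noteq> pattern_seq_squares k (2 ^ Suc a + t)"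
proof -
  obtain c u where cu: "c \<le> k" "u < 2 ^ Suc c"
    "pattern_seq_squares k (2 ^ c + u) \<noteq> pattern_seq_squares k (2 ^ Suc c + u)"
    using pattern_seq_squares_differ_base[OF assms(1)] .
  \<comment> \<open>Scaling by \<open>2 ^ d\<close> carries the example from exponent
    \<open>c\<close> to \<open>a\<close>.\<close>
  define d where "d = a - c"
  have a: "a = d + c"
    using cu(1) assms(2) by (simp add: d_def)
  have "2 ^ d * (2 ^ c + u) = 2 ^ a + 2 ^ d * u" "2 ^ d * (2 ^ Suc c + u) = 2 ^ Suc a + 2 ^ d * u"
    by (simp_all add: a power_add algebra_simps)
  then have "pattern_seq_squares k (2 ^ a + 2 ^ d * u) \<noteq> pattern_seq_squares k (2 ^ Suc a + 2 ^ d * u)"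
    using pattern_seq_squares_shift[of k d "2 ^ c + u"]
      pattern_seq_squares_shift[of k d "2 ^ Suc c + u"] cu(3) assms(1) by simp
  moreover have "2 ^ d * u < 2 ^ Suc a"
    using cu(2) by (simp add: a power_add)
  ultimately show ?thesis
    using that by blast
qed

theorem theorem2:
  fixes k N :: nat
  assumes "k \<ge> 2"
    and "N \<ge> 2 ^ (2 * k + 2)"
  shows "real (max_order_complexity (pattern_seq_squares k) N) \<ge> (real N / 8) powr (1 / 2)"
proof -
  let ?s = "pattern_seq_squares k"
  have "N > 0"
    using assms(2) by (metis gr0I le_zero_eq power_not_zero zero_neq_numeral)
  then obtain b where b: "2 ^ b \<le> N" "N < 2 ^ Suc b"
    using ex_power_ivl1[of 2 N] by auto
  have "(2::nat) ^ (2 * k + 2) < 2 ^ Suc b"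
    using assms(2) b(2) by (rule le_less_trans)
  then have "2 * k + 2 < Suc b"
    by (rule power_less_imp_less_exp[rotated]) simp
  then obtain a where a: "b = a + 2" "2 * k \<le> a"
    by (metis add_le_imp_le_right le_add_diff_inverse2 less_Suc_eq_le le_add2 order_trans)
  define D where "D t \<longleftrightarrow> ?s (2 ^ a + t) \<noteq> ?s (2 ^ Suc a + t)" for t
  obtain t where t: "t < 2 ^ Suc a" "D t"
    using pattern_seq_squares_differ[of k a] assms(1) a(2) unfolding D_def by auto
  define L where "L = (LEAST t. D t)"
  have L: "D L" "L \<le> t" "\<And>t. t < L \<Longrightarrow> \<not> D t"
    using t(2) not_less_Least unfolding L_def by (auto intro: LeastI Least_le)
  \<comment> \<open>Both summands together stay below \<open>2 ^ (a + 2) = 2 ^ b\<close>.\<close>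
  have "2 ^ Suc a + L < N"
    using L(2) t(1) b(1) a(1) by simp
  then have M: "L < max_order_complexity ?s N"
    using L by (intro max_order_complexity_gt[of "2 ^ a" L N "2 ^ Suc a"]) (auto simp: D_def)
  have "2 ^ a \<le> L ^ 2"
  proof (rule ccontr)
    assume "\<not> 2 ^ a \<le> L ^ 2"
    then have "L ^ 2 < 2 ^ a" "L ^ 2 < 2 ^ Suc a"
      by auto
    moreover have "a \<ge> 4"
      using a(2) assms(1) by simp
    ultimately have "\<not> D L"
      using ones_pattern_count_square_add_power[of k a L] ones_pattern_count_square_add_power[of k "Suc a" L]
        assms(1) by (simp add: D_def pattern_seq_squares_def pattern_seq_def)
    then show False
      using L(1) by simp
  qed
  then have "N < 8 * L ^ 2"
    using b(2) a(1) by simp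
  then have "real N < real (8 * L ^ 2)"
    by (simp only: of_nat_less_iff)
  then have "sqrt (real N / 8) \<le> real L"
    by (intro real_le_lsqrt) auto
  then show ?thesis
    using M by (simp add: powr_half_sqrt)
qed

end
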